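(* Let $p$ be the polynomial in three complex variables $$p(z_1,z_2,z_3)=\frac15\left(z_1^2+z_2^2+z_3^2-2z_1z_2-2z_1z_3-2z_2z_3\right).$$ Then $p(0)=0$ and $|p(z)|\le 1$ for all $z\in\mathbb D^3$, but $p$ is not the transfer function of any dissipative 3D scattering system with $\mathcal U=\mathcal Y=\mathbb C$; that is, there is no dissipative 3D scattering system $\alpha=(3;\mathbf A,\mathbf B,\mathbf C,\mathbf D;\mathcal X,\mathbb C,\mathbb C)$ with $\theta_\alpha(z)=p(z)$ for all $z\in\mathbb D^3$. In particular, not every contractive operator function on $\mathbb D^3$ vanishing at the origin is the transfer function of a dissipative 3D scattering system.
   Context: All Hilbert spaces are complex. $L(\mathcal H,\mathcal K)$ denotes the bounded linear operators from $\mathcal H$ to $\mathcal K$. $\mathbb D^n$ is the open unit polydisk in $\mathbb C^n$ and $\mathbb T^n$ is the unit $n$-torus $\{\zeta\in\mathbb C^n: |\zeta_k|=1 \text{ for all } k\}$. For $z\in\mathbb C^n$ and an $n$-tuple of operators $\mathbf S=(S_1,\dots,S_n)$ between the same two spaces, write $z\mathbf S:=\sum_{k=1}^n z_kS_k$. A dissipative $n$D scattering system is a tuple $\alpha=(n;\mathbf A,\mathbf B,\mathbf C,\mathbf D;\mathcal X,\mathcal U,\mathcal Y)$ where $n\ge 1$ is an integer; $\mathcal X,\mathcal U,\mathcal Y$ are Hilbert spaces; $\mathbf A,\mathbf B,\mathbf C,\mathbf D$ are $n$-tuples of operators with $A_k\in L(\mathcal X,\mathcal X)$, $B_k\in L(\mathcal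 U,\mathcal X)$, $C_k\in L(\mathcal X,\mathcal Y)$, $D_k\in L(\mathcal U,\mathcal Y)$; and, with $G_k=\begin{pmatrix}A_k&B_k\\ C_k&D_k\end{pmatrix}\in L(\mathcal X\oplus\mathcal U,\mathcal X\oplus\mathcal Y)$, the operator $\zeta\mathbf G=\sum_{k=1}^n\zeta_kG_k$ is contractive (norm at most $1$) for every $\zeta\in\mathbb T^n$. The transfer function of $\alpha$ is the $L(\mathcal U,\mathcal Y)$-valued function on $\mathbb D^n$ $$\theta_\alpha(z)=z\mathbf D+z\mathbf C\,(I_{\mathcal X}-z\mathbf A)^{-1}z\mathbf B .$$ A contractive operator function on $\mathbb D^n$ is an analytic function $\theta:\mathbb D^n\to L(\mathcal U,\mathcal Y)$ (for some Hilbert spaces $\mathcal U,\mathcal Y$) with $\|\theta(z)\|\le 1$ for all $z\in\mathbb D^n$. Scalar functions are identified with $L(\mathbb C,\mathbb C)$-valued functions. *)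

theory Defs
  imports "HOL-Analysis.Analysis"
begin

section \<open>Complex Hilbert spaces\<close>

class complex_vector = real_vector +
  fixes scaleC :: "complex \<Rightarrow> 'a \<Rightarrow> 'a"  (infixr "*\<^sub>C" 75)
  assumes scaleC_add_right: "c *\<^sub>C (x + y) = c *\<^sub>C x + c *\<^sub>C y"
    and scaleC_add_left: "(c + d) *\<^sub>C x = c *\<^sub>C x + d *\<^sub>C x"
    and scaleC_scaleC: "c *\<^sub>C (d *\<^sub>C x) = (c * d) *\<^sub>C x"
    and scaleC_of_real: "complex_of_real r *\<^sub>C x = r *\<^sub>R x"

lemma scaleC_one [simp]: "1 *\<^sub>C x = (x::'a::complex_vector)"
  using scaleC_of_real[of 1 x] by simp

class complex_normed_vector = complex_vector + real_normed_vector +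
  assumes norm_scaleC: "norm (c *\<^sub>C x) = cmod c * norm x"

text \<open>The real inner product of the library is the real part of the complex one, so that the
  norm, the topology and completeness are those of the library. The complex inner product is
  linear in its first argument; positive definiteness is inherited from \<^class>\<open>real_inner\<close>.\<close>

class complex_hilbert = complex_normed_vector + real_inner + complete_space +
  fixes cinner :: "'a \<Rightarrow> 'a \<Rightarrow> complex"
  assumes cinner_commute: "cinner x y = cnj (cinner y x)"
    and cinner_add_left: "cinner (x + y) w = cinner x w + cinner y w"
    and cinner_scaleC_left: "cinner (c *\<^sub>C x) y = c * cinner x y"
    and inner_eq_Re_cinner: "inner x y = Re (cinner x y)"

lemma cinner_self:
  fixes x :: "'a::complex_hilbert"
  shows "cinner x x = complex_of_real ((norm x)\<^sup>2)"
proof -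
  have "Im (cinner x x) = 0"
    using arg_cong[OF cinner_commute[of x x], of Im] by simp
  then show ?thesis
    using inner_eq_Re_cinner[of x x] by (simp add: complex_eq_iff power2_norm_eq_inner)
qed

instantiation complex :: complex_hilbert
begin
definition scaleC_complex :: "complex \<Rightarrow> complex \<Rightarrow> complex"
  where "scaleC_complex c x = c * x"
definition cinner_complex :: "complex \<Rightarrow> complex \<Rightarrow> complex"
  where "cinner_complex x y = x * cnj y"
instance
  by standard
    (auto simp: scaleC_complex_def cinner_complex_def algebra_simps norm_mult scaleR_conv_of_real
      inner_complex_def)
end

text \<open>The product type carries the Hilbert direct sum: its library norm is
  \<open>sqrt ((norm x)\<^sup>2 + (norm y)\<^sup>2)\<close>.\<close>

instantiation prod :: (complex_vector, complex_vector) complex_vector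
begin
definition scaleC_prod :: "complex \<Rightarrow> 'a \<times> 'b \<Rightarrow> 'a \<times> 'b"
  where "scaleC_prod c x = (c *\<^sub>C fst x, c *\<^sub>C snd x)"
instance
  by standard
    (auto simp: scaleC_prod_def scaleC_add_right scaleC_add_left scaleC_scaleC scaleC_of_real
      prod_eq_iff)
end

instance prod :: (complex_normed_vector, complex_normed_vector) complex_normed_vector
proof
  fix c :: complex and x :: "'a \<times> 'b"
  have "(cmod c)\<^sup>2 * (norm (fst x))\<^sup>2 + (cmod c)\<^sup>2 * (norm (snd x))\<^sup>2
      = (cmod c)\<^sup>2 * ((norm (fst x))\<^sup>2 + (norm (snd x))\<^sup>2)"
    by (simp add: distrib_left)
  then show "norm (c *\<^sub>C x) = cmod c * norm x"
    by (simp add: scaleC_prod_def norm_prod_def norm_scaleC power_mult_distrib real_sqrt_mult)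
qed

instantiation prod :: (complex_hilbert, complex_hilbert) complex_hilbert
begin
definition cinner_prod :: "'a \<times> 'b \<Rightarrow> 'a \<times> 'b \<Rightarrow> complex"
  where "cinner_prod x y = cinner (fst x) (fst y) + cinner (snd x) (snd y)"
instance
proof
  fix x y w :: "'a \<times> 'b" and c :: complex
  show "cinner x y = cnj (cinner y x)"
    unfolding cinner_prod_def complex_cnj_add
    using cinner_commute[of "fst x" "fst y"] cinner_commute[of "snd x" "snd y"] by simp
  show "cinner (x + y) w = cinner x w + cinner y w"
    by (simp add: cinner_prod_def cinner_add_left)
  show "cinner (c *\<^sub>C x) y = c * cinner x y"
    by (simp add: cinner_prod_def scaleC_prod_def cinner_scaleC_left distrib_left)
  show "inner x y = Re (cinner x y)"
    by (simp add: cinner_prod_def inner_prod_def inner_eq_Re_cinner)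
qed
end

section \<open>Bounded complex-linear operators\<close>

lemma bounded_linear_scaleC:
  "bounded_linear (\<lambda>x::'a::complex_normed_vector. c *\<^sub>C x)"
proof (rule bounded_linear_intro[where K = "cmod c"])
  fix r :: real and x y :: 'a
  show "c *\<^sub>C (x + y) = c *\<^sub>C x + c *\<^sub>C y"
    by (rule scaleC_add_right)
  show "c *\<^sub>C (r *\<^sub>R x) = r *\<^sub>R (c *\<^sub>C x)"
    by (simp flip: scaleC_of_real add: scaleC_scaleC mult.commute)
  show "norm (c *\<^sub>C x) \<le> norm x * cmod c"
    by (simp add: norm_scaleC mult.commute)
qed

text \<open>The library type of bounded real-linear maps, with its operator norm, becomes a complex
  normed space by acting on values; \<open>bounded_clinear_ops\<close> is the closed subspace of
  complex-linear operators, i.e. the space \<open>L(H, K)\<close>.\<close>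

instantiation blinfun :: (real_normed_vector, complex_normed_vector) complex_normed_vector
begin
definition scaleC_blinfun :: "complex \<Rightarrow> 'a \<Rightarrow>\<^sub>L 'b \<Rightarrow> 'a \<Rightarrow>\<^sub>L 'b"
  where "scaleC_blinfun c T = Blinfun (\<lambda>x. c *\<^sub>C blinfun_apply T x)"
instance
proof
  have app: "blinfun_apply (c *\<^sub>C T) x = c *\<^sub>C blinfun_apply T x"
    for c :: complex and T :: "'a \<Rightarrow>\<^sub>L 'b" and x
    unfolding scaleC_blinfun_def
    by (subst bounded_linear_Blinfun_apply)
      (auto intro: bounded_linear_compose[OF bounded_linear_scaleC] blinfun.bounded_linear_right)
  fix c d :: complex and r :: real and S T :: "'a \<Rightarrow>\<^sub>L 'b"
  show "c *\<^sub>C (S + T) = c *\<^sub>C S + c *\<^sub>C T"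
    by (rule blinfun_eqI) (simp add: app blinfun.add_left scaleC_add_right)
  show "(c + d) *\<^sub>C T = c *\<^sub>C T + d *\<^sub>C T"
    by (rule blinfun_eqI) (simp add: app blinfun.add_left scaleC_add_left)
  show "c *\<^sub>C d *\<^sub>C T = (c * d) *\<^sub>C T"
    by (rule blinfun_eqI) (simp add: app scaleC_scaleC)
  show "complex_of_real r *\<^sub>C T = r *\<^sub>R T"
    by (rule blinfun_eqI) (simp add: app scaleC_of_real blinfun.scaleR_left)
  have le: "norm (e *\<^sub>C R) \<le> cmod e * norm R" for e :: complex and R :: "'a \<Rightarrow>\<^sub>L 'b"
    by (rule norm_blinfun_bound)
      (auto simp: app norm_scaleC mult.assoc intro!: mult_left_mono norm_blinfun)
  show "norm (c *\<^sub>C T) = cmod c * norm T"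
  proof (cases "c = 0")
    case True
    then show ?thesis using le[of c T] by simp
  next
    case False
    have "inverse c *\<^sub>C c *\<^sub>C T = T"
      using False by (intro blinfun_eqI) (simp add: app scaleC_scaleC)
    then have "norm T \<le> cmod (inverse c) * norm (c *\<^sub>C T)"
      using le[of "inverse c" "c *\<^sub>C T"] by simp
    then have "cmod c * norm T \<le> norm (c *\<^sub>C T)"
      using False by (simp add: norm_inverse norm_divide field_simps)
    then show ?thesis using le[of c T] by linarith
  qed
qed
end

lemma scaleC_blinfun_apply [simp]:
  "blinfun_apply (c *\<^sub>C T) x = c *\<^sub>C blinfun_apply T x"
  unfolding scaleC_blinfun_def
  by (subst bounded_linear_Blinfun_apply)
    (auto intro: bounded_linear_compose[OF bounded_linear_scaleC] blinfun.bounded_linear_right)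

definition bounded_clinear_ops ::
    "('a::complex_normed_vector \<Rightarrow>\<^sub>L 'b::complex_normed_vector) set"
  where "bounded_clinear_ops =
    {T. \<forall>c x. blinfun_apply T (c *\<^sub>C x) = c *\<^sub>C blinfun_apply T x}"

text \<open>Two-sided inverse in the algebra of bounded operators (unspecified if there is none).\<close>

definition blinfun_inverse :: "('a::real_normed_vector \<Rightarrow>\<^sub>L 'a) \<Rightarrow> ('a \<Rightarrow>\<^sub>L 'a)"
  where "blinfun_inverse T =
    (THE S. S o\<^sub>L T = id_blinfun \<and> T o\<^sub>L S = id_blinfun)"

lemma blinfun_inverse_eqI:
  assumes "S o\<^sub>L T = id_blinfun" and "T o\<^sub>L S = id_blinfun"
  shows "blinfun_inverse T = S"
  unfolding blinfun_inverse_def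
proof (rule the_equality)
  fix R assume R: "R o\<^sub>L T = id_blinfun \<and> T o\<^sub>L R = id_blinfun"
  have "R = R o\<^sub>L (T o\<^sub>L S)"
    using assms(2) by (auto intro: blinfun_eqI)
  also have "\<dots> = (R o\<^sub>L T) o\<^sub>L S"
    by (auto intro: blinfun_eqI)
  also have "\<dots> = S"
    using R by (auto intro: blinfun_eqI)
  finally show "R = S" .
qed (use assms in auto)

definition block_op ::
    "('x::real_normed_vector \<Rightarrow>\<^sub>L 'v::real_normed_vector) \<Rightarrow> ('u::real_normed_vector \<Rightarrow>\<^sub>L 'v)
      \<Rightarrow> ('x \<Rightarrow>\<^sub>L 'y::real_normed_vector) \<Rightarrow> ('u \<Rightarrow>\<^sub>L 'y) \<Rightarrow> (('x \<times> 'u) \<Rightarrow>\<^sub>L ('v \<times> 'y))"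
  where "block_op A B C D = Blinfun (\<lambda>(x, u).
    (blinfun_apply A x + blinfun_apply B u, blinfun_apply C x + blinfun_apply D u))"

lemma block_op_apply [simp]:
  "blinfun_apply (block_op A B C D) (x, u) =
    (blinfun_apply A x + blinfun_apply B u, blinfun_apply C x + blinfun_apply D u)"
proof -
  have "bounded_linear (\<lambda>(x, u).
      (blinfun_apply A x + blinfun_apply B u, blinfun_apply C x + blinfun_apply D u))"
    unfolding case_prod_unfold
    by (intro bounded_linear_Pair bounded_linear_add
        bounded_linear_compose[OF blinfun.bounded_linear_right]
        bounded_linear_fst bounded_linear_snd)
  then show ?thesis
    by (simp add: block_op_def bounded_linear_Blinfun_apply)
qed

section \<open>Dissipative scattering systems and their transfer functions\<close>

definition polydisk :: "(complex ^ 'n) set"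
  where "polydisk = {z. \<forall>k. cmod (z $ k) < 1}"

definition torus :: "(complex ^ 'n) set"
  where "torus = {\<zeta>. \<forall>k. cmod (\<zeta> $ k) = 1}"

definition tuple_comb :: "complex ^ 'n \<Rightarrow> ('n::finite \<Rightarrow> 'a) \<Rightarrow> 'a::complex_vector"
  where "tuple_comb z S = (\<Sum>k\<in>UNIV. (z $ k) *\<^sub>C S k)"

text \<open>The number of variables is the cardinality of the finite index type \<open>'n\<close>.\<close>

record (overloaded) ('n, 'x, 'u, 'y) scattering_system =
  opA :: "'n \<Rightarrow> ('x::complex_hilbert \<Rightarrow>\<^sub>L 'x)"
  opB :: "'n \<Rightarrow> ('u::complex_hilbert \<Rightarrow>\<^sub>L 'x)"
  opC :: "'n \<Rightarrow> ('x \<Rightarrow>\<^sub>L 'y::complex_hilbert)"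
  opD :: "'n \<Rightarrow> ('u \<Rightarrow>\<^sub>L 'y)"

definition system_op ::
    "('n, 'x::complex_hilbert, 'u::complex_hilbert, 'y::complex_hilbert) scattering_system
      \<Rightarrow> 'n \<Rightarrow> (('x \<times> 'u) \<Rightarrow>\<^sub>L ('x \<times> 'y))"
  where "system_op \<alpha> k = block_op (opA \<alpha> k) (opB \<alpha> k) (opC \<alpha> k) (opD \<alpha> k)"

definition dissipative ::
    "('n::finite, 'x::complex_hilbert, 'u::complex_hilbert, 'y::complex_hilbert) scattering_system
      \<Rightarrow> bool"
  where "dissipative \<alpha> \<longleftrightarrow>
    (\<forall>k. opA \<alpha> k \<in> bounded_clinear_ops \<and> opB \<alpha> k \<in> bounded_clinear_ops \<and>
         opC \<alpha> k \<in> bounded_clinear_ops \<and> opD \<alpha> k \<in> bounded_clinear_ops) \<and>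
    (\<forall>\<zeta>\<in>torus. norm (tuple_comb \<zeta> (system_op \<alpha>)) \<le> 1)"

definition transfer_function ::
    "('n::finite, 'x::complex_hilbert, 'u::complex_hilbert, 'y::complex_hilbert) scattering_system
      \<Rightarrow> complex ^ 'n \<Rightarrow> ('u \<Rightarrow>\<^sub>L 'y)"
  where "transfer_function \<alpha> z =
    tuple_comb z (opD \<alpha>) +
    (tuple_comb z (opC \<alpha>) o\<^sub>L
      (blinfun_inverse (id_blinfun - tuple_comb z (opA \<alpha>)) o\<^sub>L tuple_comb z (opB \<alpha>)))"

text \<open>Analyticity on the (open) polydisk: complex Frechet differentiability at each point.\<close>

definition contractive_operator_function ::
    "(complex ^ 'n::finite \<Rightarrow> ('u::complex_hilbert \<Rightarrow>\<^sub>L 'y::complex_hilbert)) \<Rightarrow> bool"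
  where "contractive_operator_function \<theta> \<longleftrightarrow>
    (\<forall>z\<in>polydisk. \<theta> z \<in> bounded_clinear_ops) \<and>
    (\<forall>z\<in>polydisk. \<exists>\<theta>'. (\<theta> has_derivative \<theta>') (at z) \<and>
        (\<forall>c v. \<theta>' (c *s v) = c *\<^sub>C \<theta>' v)) \<and>
    (\<forall>z\<in>polydisk. norm (\<theta> z) \<le> 1)"

definition scalar_op :: "complex \<Rightarrow> (complex \<Rightarrow>\<^sub>L complex)"
  where "scalar_op c = c *\<^sub>C id_blinfun"

lemma scalar_op_apply [simp]: "blinfun_apply (scalar_op c) x = c * x"
  by (simp add: scalar_op_def scaleC_complex_def)

definition p_poly :: "complex ^ 3 \<Rightarrow> complex"
  where "p_poly z = 1 / 5 * ((z $ 1)\<^sup>2 + (z $ 2)\<^sup>2 + (z $ 3)\<^sup>2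
    - 2 * (z $ 1) * (z $ 2) - 2 * (z $ 1) * (z $ 3) - 2 * (z $ 2) * (z $ 3))"

end

theory Submission
  imports Defs "HOL-Complex_Analysis.Conformal_Mappings"
begin

text \<open>The bound on \<open>p\<close>: by the maximum principle in each variable one may take \<open>z\<close> on the torus,
  and there \<open>z\<^sub>2 = u v\<close>, \<open>z\<^sub>3 = u / v\<close> with unimodular \<open>u\<close>, \<open>v\<close>, so that
  \<open>5 p(z) = u\<^sup>2 ((w - 2 c)\<^sup>2 - 4)\<close> with \<open>w = z\<^sub>1 / u\<close> and \<open>c = Re v\<close>.

  No realization: comparing the terms of order two in \<open>t\<close> in \<open>\<theta>(t \<zeta>) = p(t \<zeta>)\<close> gives
  \<open>p(\<zeta>) = \<zeta>C \<zeta>B\<close> on the torus, where \<open>\<zeta>B\<close> and \<open>\<zeta>C\<close> are contractions.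
  Hence \<open>\<bar>C(cnj z) B(z)\<bar> \<le> 1\<close> for all \<open>z\<close> in the torus, whereas for the cube roots of unity
  \<open>z = (1, \<omega>, \<omega>\<^sup>2)\<close> the coefficients of \<open>p\<close> force
  \<open>C(cnj z) B(z) + C(z) B(cnj z) = 12 / 5\<close>.\<close>

section \<open>The bound on the polynomial\<close>

text \<open>Up to the factor 8 this is the slack in the bound 25 for the squared modulus below. Only
  opposite signs of \<open>c\<close> and \<open>x\<close> need work; there
  \<open>(c - x)\<^sup>2\<close> is bounded below by \<open>- 4 * (c * x)\<close>.\<close>

lemma quadratic_nonneg_on_square:
  fixes c x :: real
  assumes "\<bar>c\<bar> \<le> 1" "\<bar>x\<bar> \<le> 1"
  shows "0 \<le> 2 * (1 - c\<^sup>2) * (c - x)\<^sup>2 + c * (c + x)"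
proof -
  have c2: "c\<^sup>2 \<le> 1"
    using assms(1) by (simp add: abs_square_le_1)
  show ?thesis
  proof (cases "c * x \<ge> 0")
    case True
    have "0 \<le> 2 * (1 - c\<^sup>2) * (c - x)\<^sup>2"
      using c2 by (intro mult_nonneg_nonneg) auto
    moreover have "c * (c + x) = c\<^sup>2 + c * x"
      by (simp add: power2_eq_square algebra_simps)
    ultimately show ?thesis
      using True zero_le_power2[of c] by linarith
  next
    case False
    define a where "a = \<bar>c\<bar>"
    define y where "y = \<bar>x\<bar>"
    have ay: "0 \<le> a" "a \<le> 1" "0 \<le> y" "y \<le> 1"
      using assms by (auto simp: a_def y_def)
    have cx: "c * x = - (a * y)"
      using False by (simp add: a_def y_def flip: abs_mult)
    have ca: "c\<^sup>2 = a\<^sup>2"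
      by (simp add: a_def)
    \<comment> \<open>After that lower bound, \<open>a\<^sup>2 + a * y * (7 - 8 * a\<^sup>2)\<close>
      has to be nonnegative. This product is \<open>7 + a - 8 * a\<^sup>2\<close>, so the second
      summand is at least \<open>- a\<^sup>2 * y\<close>.\<close>
    have "0 \<le> (8 * a + 7) * (1 - a)"
      using ay by (intro mult_nonneg_nonneg) auto
    then have "- a \<le> 7 - 8 * a\<^sup>2"
      by (simp add: power2_eq_square algebra_simps)
    then have "(a * y) * (- a) \<le> (a * y) * (7 - 8 * a\<^sup>2)"
      using ay by (intro mult_left_mono) auto
    moreover have "a\<^sup>2 * y \<le> a\<^sup>2 * 1"
      using ay by (intro mult_left_mono) auto
    ultimately have "0 \<le> a\<^sup>2 + (a * y) * (7 - 8 * a\<^sup>2)"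
      by (simp add: power2_eq_square algebra_simps)
    also have "\<dots> = 2 * (1 - c\<^sup>2) * (- 4 * (c * x)) + (c\<^sup>2 + c * x)"
      unfolding cx ca by (simp add: algebra_simps)
    also have "\<dots> \<le> 2 * (1 - c\<^sup>2) * (c - x)\<^sup>2 + (c\<^sup>2 + c * x)"
    proof -
      have "- 4 * (c * x) \<le> (c - x)\<^sup>2"
        using zero_le_power2[of "c + x"] by (simp add: power2_eq_square algebra_simps)
      then show ?thesis
        using c2 by (intro add_right_mono mult_left_mono) auto
    qed
    finally show ?thesis
      by (simp add: power2_eq_square algebra_simps)
  qed
qed

text \<open>The difference of squares factors into distances from \<open>w\<close> to the real
  points \<open>2 * c + 2\<close> and \<open>2 * c - 2\<close>. By the law of cosines the squared
  modulus is then a real polynomial in \<open>c\<close> and \<open>Re w\<close>.\<close>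

lemma cmod_sub_square_le:
  assumes w: "cmod w = 1" and c: "\<bar>c\<bar> \<le> 1"
  shows "cmod ((w - 2 * complex_of_real c)\<^sup>2 - 4) \<le> 5"
proof -
  define x where "x = Re w"
  have xy: "(Im w)\<^sup>2 = 1 - x\<^sup>2"
    using w cmod_power2[of w] by (simp add: x_def)
  have x: "\<bar>x\<bar> \<le> 1"
    using abs_Re_le_cmod[of w] w by (simp add: x_def)
  have sq: "(cmod (w - complex_of_real r))\<^sup>2 = 1 + r\<^sup>2 - 2 * r * x" for r
    by (simp add: cmod_power2 xy) (simp add: x_def power2_eq_square algebra_simps)
  have "(w - 2 * complex_of_real c)\<^sup>2 - 4
      = (w - complex_of_real (2 * c + 2)) * (w - complex_of_real (2 * c - 2))"
    by (simp add: power2_eq_square algebra_simps)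
  then have "(cmod ((w - 2 * complex_of_real c)\<^sup>2 - 4))\<^sup>2
      = (1 + (2 * c + 2)\<^sup>2 - 2 * (2 * c + 2) * x) * (1 + (2 * c - 2)\<^sup>2 - 2 * (2 * c - 2) * x)"
    by (simp only: norm_mult power_mult_distrib sq)
  also have "\<dots> = 25 - 8 * (2 * (1 - c\<^sup>2) * (c - x)\<^sup>2 + c * (c + x))"
    by (simp add: power2_eq_square algebra_simps)
  also have "\<dots> \<le> 5\<^sup>2"
    using quadratic_nonneg_on_square[OF c x]
    by (simp del: distrib_left_numeral right_diff_distrib_numeral left_diff_distrib_numeral)
  finally show ?thesis
    by (rule power2_le_imp_le) simp
qed

text \<open>The Kaijser-Varopoulos polynomial, with separate scalar arguments so that one-variable
  complex analysis applies to each.\<close>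

definition kv_form :: "complex \<Rightarrow> complex \<Rightarrow> complex \<Rightarrow> complex"
  where "kv_form a b d = a\<^sup>2 + b\<^sup>2 + d\<^sup>2 - 2 * a * b - 2 * a * d - 2 * b * d"

lemma kv_form_le_torus:
  assumes a: "cmod a = 1" and b: "cmod b = 1" and d: "cmod d = 1"
  shows "cmod (kv_form a b d) \<le> 5"
proof -
  \<comment> \<open>A square root of \<open>b * d\<close> makes \<open>b / u\<close> and
    \<open>d / u\<close> conjugate to each other; homogeneity of degree two then lets
    \<open>u\<^sup>2\<close> factor out.\<close>
  define u where "u = csqrt (b * d)"
  define v where "v = b / u"
  define w where "w = a / u"
  have u2: "u\<^sup>2 = b * d"
    by (simp add: u_def)
  have "(cmod u)\<^sup>2 = 1"
    using u2 b d by (simp add: norm_mult flip: norm_power)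
  then have u: "cmod u = 1"
    by (simp add: power2_eq_1_iff) (metis norm_ge_zero neg_0_le_iff_le not_one_le_zero)
  then have u0: "u \<noteq> 0"
    by auto
  have v: "cmod v = 1" and w: "cmod w = 1"
    using a b u by (auto simp: v_def w_def norm_divide)
  have vv: "v * cnj v = 1"
    using v by (simp add: complex_norm_square[symmetric])
  have b': "b = u * v" and a': "a = u * w"
    using u0 by (auto simp: v_def w_def)
  have "b * d = u\<^sup>2 * (v * cnj v)"
    by (simp add: vv u2)
  also have "\<dots> = b * (u * cnj v)"
    by (simp add: b' power2_eq_square)
  finally have d': "d = u * cnj v"
    using b by auto
  define c where "c = complex_of_real (Re v)"
  have c2: "v + cnj v = 2 * c"
    unfolding c_def by (simp add: complex_add_cnj)
  have cnjv: "cnj v = 2 * c - v"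
    using c2 by (simp add: algebra_simps)
  have v2: "v\<^sup>2 = 2 * c * v - 1"
    using vv unfolding cnjv by (simp add: power2_eq_square algebra_simps)
  have "kv_form a b d = u\<^sup>2 * (w\<^sup>2 + v\<^sup>2 + (2 * c - v)\<^sup>2 - 2 * w * (2 * c) - 2 * (v * (2 * c - v)))"
    unfolding kv_form_def a' b' d' cnjv by (simp add: power2_eq_square algebra_simps)
  \<comment> \<open>The last summand is a multiple of the quadratic equation satisfied by
    \<open>v\<close>, whose roots \<open>v\<close> and \<open>cnj v\<close> have sum
    \<open>2 * c\<close> and product 1.\<close>
  also have "w\<^sup>2 + v\<^sup>2 + (2 * c - v)\<^sup>2 - 2 * w * (2 * c) - 2 * (v * (2 * c - v))
     = (w - 2 * c)\<^sup>2 - 4 + 4 * (v\<^sup>2 - (2 * c * v - 1))"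
    by (simp add: power2_eq_square algebra_simps)
  also have "\<dots> = (w - 2 * c)\<^sup>2 - 4"
    unfolding v2 by simp
  finally have "cmod (kv_form a b d) = cmod ((w - 2 * c)\<^sup>2 - 4)"
    using u by (simp add: norm_mult norm_power)
  also have "\<dots> \<le> 5"
    unfolding c_def using abs_Re_le_cmod[of v] v by (intro cmod_sub_square_le w) simp
  finally show ?thesis .
qed

section \<open>From the torus to the polydisk\<close>

lemma maximum_modulus_unit_disk:
  assumes "f holomorphic_on UNIV" and "\<And>z. cmod z = 1 \<Longrightarrow> cmod (f z) \<le> M"
    and "cmod z < 1"
  shows "cmod (f z) \<le> M"
proof (rule maximum_modulus_frontier[of f "cball 0 1"])
  show "f holomorphic_on interior (cball 0 1)"
    using assms(1) by (rule holomorphic_on_subset) simp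
  show "continuous_on (closure (cball 0 1)) f"
    using holomorphic_on_imp_continuous_on[OF assms(1)] by (rule continuous_on_subset) simp
qed (use assms in auto)

text \<open>The variables move from the circle into the disk one at a time: first \<open>d\<close>,
  then \<open>b\<close>, then \<open>a\<close>.\<close>

lemma kv_form_le_polydisk:
  assumes "cmod a < 1" "cmod b < 1" "cmod d < 1"
  shows "cmod (kv_form a b d) \<le> 5"
proof -
  have hol: "(\<lambda>z. kv_form z b d) holomorphic_on UNIV" "(\<lambda>z. kv_form a z d) holomorphic_on UNIV"
    "(\<lambda>z. kv_form a b z) holomorphic_on UNIV" for a b d
    unfolding kv_form_def by (intro holomorphic_intros)+
  have 1: "cmod (kv_form x y d) \<le> 5" if "cmod x = 1" "cmod y = 1" for x y
    by (rule maximum_modulus_unit_disk[OF hol(3) _ assms(3)]) (use kv_form_le_torus that in auto)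
  have 2: "cmod (kv_form x b d) \<le> 5" if "cmod x = 1" for x
    by (rule maximum_modulus_unit_disk[OF hol(2) _ assms(2)]) (use 1 that in auto)
  show ?thesis
    by (rule maximum_modulus_unit_disk[OF hol(1) _ assms(1)]) (use 2 in auto)
qed

lemma p_poly_eq_kv_form: "p_poly z = kv_form (z $ 1) (z $ 2) (z $ 3) / 5"
  by (simp add: p_poly_def kv_form_def)

lemma cmod_p_poly_le: "z \<in> polydisk \<Longrightarrow> cmod (p_poly z) \<le> 1"
  using kv_form_le_polydisk[of "z $ 1" "z $ 2" "z $ 3"]
  by (simp add: p_poly_eq_kv_form polydisk_def norm_divide)

section \<open>Analyticity and contractivity of the polynomial\<close>

lemma contractive_p_poly: "contractive_operator_function (\<lambda>z. scalar_op (p_poly z))"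
  unfolding contractive_operator_function_def
proof (intro conjI ballI)
  fix z :: "complex ^ 3"
  assume z: "z \<in> polydisk"
  show "scalar_op (p_poly z) \<in> bounded_clinear_ops"
    by (simp add: bounded_clinear_ops_def scaleC_complex_def)
  have "norm (id_blinfun :: complex \<Rightarrow>\<^sub>L complex) \<le> 1"
    by (rule norm_blinfun_bound) auto
  then have "cmod (p_poly z) * norm (id_blinfun :: complex \<Rightarrow>\<^sub>L complex) \<le> 1 * 1"
    using cmod_p_poly_le[OF z] by (intro mult_mono) auto
  then show "norm (scalar_op (p_poly z)) \<le> 1"
    by (simp add: scalar_op_def norm_scaleC)
  \<comment> \<open>The differential of p at \<open>z\<close>, written out so that its complex
    homogeneity in \<open>v\<close> can be read off.\<close>
  define p' where "p' = (\<lambda>v :: complex ^ 3. 1 / 5 * (2 * z $ 1 * v $ 1 + 2 * z $ 2 * v $ 2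
    + 2 * z $ 3 * v $ 3 - 2 * (z $ 1 * v $ 2 + v $ 1 * z $ 2)
    - 2 * (z $ 1 * v $ 3 + v $ 1 * z $ 3) - 2 * (z $ 2 * v $ 3 + v $ 2 * z $ 3)))"
  have bl: "bounded_linear scalar_op"
  proof (rule bounded_linear_intro[where K = "norm (id_blinfun :: complex \<Rightarrow>\<^sub>L complex)"])
    show "scalar_op (x + y) = scalar_op x + scalar_op y" for x y
      by (simp add: scalar_op_def scaleC_add_left)
    show "scalar_op (r *\<^sub>R x) = r *\<^sub>R scalar_op x" for r x
      by (simp add: scalar_op_def scaleR_conv_of_real flip: scaleC_of_real scaleC_scaleC)
    show "norm (scalar_op x) \<le> norm x * norm (id_blinfun :: complex \<Rightarrow>\<^sub>L complex)" for x
      by (simp add: scalar_op_def norm_scaleC)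
  qed
  have nth: "((\<lambda>x :: complex ^ 3. x $ k) has_derivative (\<lambda>v. v $ k)) (at z)" for k
    by (rule bounded_linear.has_derivative[OF bounded_linear_vec_nth has_derivative_ident])
  have "(p_poly has_derivative p') (at z)"
    unfolding p_poly_def p'_def
    by (rule derivative_eq_intros nth refl | simp add: power2_eq_square algebra_simps)+
  then have "((\<lambda>z. scalar_op (p_poly z)) has_derivative (\<lambda>v. scalar_op (p' v))) (at z)"
    by (rule bounded_linear.has_derivative[OF bl])
  moreover have "scalar_op (p' (c *s v)) = c *\<^sub>C scalar_op (p' v)" for c v
    by (simp add: scalar_op_def scaleC_scaleC p'_def algebra_simps)
  ultimately show "\<exists>\<theta>'. ((\<lambda>z. scalar_op (p_poly z)) has_derivative \<theta>') (at z) \<and>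
      (\<forall>c v. \<theta>' (c *s v) = c *\<^sub>C \<theta>' v)"
    by blast
qed

section \<open>Neumann inverses\<close>

text \<open>Solving \<open>x - T x = y\<close> means finding a fixed point of the contraction
  \<open>x \<mapsto> y + T x\<close>, so Banach's theorem gives bijectivity. The fixed-point
  equation also bounds the inverse by \<open>1 / (1 - norm T)\<close>.\<close>

lemma blinfun_neumann_inverse:
  fixes T :: "'a::{real_normed_vector, complete_space} \<Rightarrow>\<^sub>L 'a"
  assumes T: "norm T < 1"
  shows "(id_blinfun - T) o\<^sub>L blinfun_inverse (id_blinfun - T) = id_blinfun"
proof -
  define f where "f = blinfun_apply (id_blinfun - T)"
  have f: "f x = x - T x" for x
    by (simp add: f_def blinfun.diff_left)
  have lin: "linear f"
    unfolding f_def by (rule bounded_linear.linear[OF blinfun.bounded_linear_right])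
  have ex1: "\<exists>!x. f x = y" for y
  proof -
    have "\<exists>!x. y + T x = x"
    proof (rule banach_fix_type[OF norm_ge_zero T], intro allI)
      fix x x'
      show "dist (y + T x) (y + T x') \<le> norm T * dist x x'"
        using norm_blinfun[of T "x - x'"] by (simp add: dist_norm blinfun.diff_right)
    qed
    then show ?thesis
      by (simp add: f algebra_simps) (metis)
  qed
  then have bij: "bij f"
    by (metis bij_iff)
  then have fg: "f (inv f y) = y" and gf: "inv f (f y) = y" for y
    by (auto simp: bij_is_inj bij_is_surj surj_f_inv_f)
  have "bounded_linear (inv f)"
  proof (rule bounded_linear_intro[where K = "1 / (1 - norm T)"])
    show "inv f (x + y) = inv f x + inv f y" for x y
      by (metis fg gf linear_add[OF lin])
    show "inv f (r *\<^sub>R x) = r *\<^sub>R inv f x" for r x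
      by (metis fg gf linear_scale[OF lin])
    fix y
    have "inv f y = y + T (inv f y)"
      using fg[of y] by (simp add: f algebra_simps)
    then have "norm (inv f y) \<le> norm y + norm T * norm (inv f y)"
      by (metis norm_triangle_mono order_refl norm_blinfun)
    then show "norm (inv f y) \<le> norm y * (1 / (1 - norm T))"
      using T by (simp add: field_simps)
  qed
  then have S: "blinfun_apply (Blinfun (inv f)) = inv f"
    by (rule bounded_linear_Blinfun_apply)
  have "(id_blinfun - T) o\<^sub>L Blinfun (inv f) = id_blinfun"
    "Blinfun (inv f) o\<^sub>L (id_blinfun - T) = id_blinfun"
    by (auto intro!: blinfun_eqI simp: S fg gf simp flip: f_def)
  then show ?thesis
    using blinfun_inverse_eqI by metis
qed

section \<open>Quadratic transfer functions\<close>

lemma tuple_comb_apply: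
  "blinfun_apply (tuple_comb z S) x = (\<Sum>k\<in>UNIV. (z $ k) *\<^sub>C blinfun_apply (S k) x)"
  by (simp add: tuple_comb_def blinfun.sum_left)

lemma tuple_comb_scale:
  fixes S :: "'n::finite \<Rightarrow> 'a::complex_vector"
  shows "tuple_comb (complex_of_real t *s z) S = t *\<^sub>R tuple_comb z S"
  by (simp add: tuple_comb_def scaleR_sum_right scaleC_of_real flip: scaleC_scaleC)

lemma tuple_comb_system_op:
  "blinfun_apply (tuple_comb z (system_op \<alpha>)) (x, u) =
    (tuple_comb z (opA \<alpha>) x + tuple_comb z (opB \<alpha>) u,
     tuple_comb z (opC \<alpha>) x + tuple_comb z (opD \<alpha>) u)"
  by (simp add: tuple_comb_apply system_op_def scaleC_prod_def scaleC_add_right sum.distrib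
      prod_eq_iff fst_sum snd_sum)

text \<open>Inputs \<open>(x, 0)\<close> and \<open>(0, u)\<close> isolate the block columns, and a
  component of a direct sum is no longer than the whole vector.\<close>

lemma dissipative_contractive:
  assumes "dissipative \<alpha>" "\<zeta> \<in> torus"
  shows "norm (tuple_comb \<zeta> (opA \<alpha>)) \<le> 1" "norm (tuple_comb \<zeta> (opB \<alpha>)) \<le> 1"
    "norm (tuple_comb \<zeta> (opC \<alpha>)) \<le> 1"
proof -
  have G: "norm (tuple_comb \<zeta> (system_op \<alpha>) w) \<le> norm w" for w
    using norm_blinfun[of "tuple_comb \<zeta> (system_op \<alpha>)" w] assms
    by (meson dissipative_def mult_left_le_one_le norm_ge_zero order_trans)
  have x: "norm (tuple_comb \<zeta> (opA \<alpha>) x, tuple_comb \<zeta> (opC \<alpha>) x) \<le> norm x" for x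
    using G[of "(x, 0)"] by (simp add: tuple_comb_system_op)
  have u: "norm (tuple_comb \<zeta> (opB \<alpha>) u, tuple_comb \<zeta> (opD \<alpha>) u) \<le> norm u" for u
    using G[of "(0, u)"] by (simp add: tuple_comb_system_op)
  show "norm (tuple_comb \<zeta> (opA \<alpha>)) \<le> 1"
    using order_trans[OF norm_fst_le x] by (intro norm_blinfun_bound) auto
  show "norm (tuple_comb \<zeta> (opB \<alpha>)) \<le> 1"
    using order_trans[OF norm_fst_le u] by (intro norm_blinfun_bound) auto
  show "norm (tuple_comb \<zeta> (opC \<alpha>)) \<le> 1"
    using order_trans[OF norm_snd_le x] by (intro norm_blinfun_bound) auto
qed

text \<open>Subtracting the estimates at \<open>t\<close> and \<open>t/2\<close> eliminates
  \<open>a\<close>; dividing by \<open>t/2\<close> bounds \<open>norm b\<close> by a multiple of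
  \<open>t\<close>, which tends to 0.\<close>

lemma linear_term_zero_if_quadratic_bound:
  fixes a b :: "'a::real_normed_vector"
  assumes bound: "\<And>t::real. 0 < t \<Longrightarrow> t \<le> 1/2 \<Longrightarrow> norm (a + t *\<^sub>R b) \<le> K * t\<^sup>2"
  shows "b = 0"
proof -
  have le: "norm b \<le> (5/2 * K) * t" if t: "0 < t" "t \<le> 1/2" for t
  proof -
    have "norm ((t/2) *\<^sub>R b) = norm ((a + t *\<^sub>R b) - (a + (t/2) *\<^sub>R b))"
      by (simp add: flip: scaleR_left_diff_distrib)
    also have "\<dots> \<le> K * t\<^sup>2 + K * (t/2)\<^sup>2"
      using norm_triangle_ineq4[of "a + t *\<^sub>R b" "a + (t/2) *\<^sub>R b"] bound[of t] bound[of "t/2"] t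
      by simp
    finally have "t * norm b \<le> t * ((5/2 * K) * t)"
      using t by (simp add: power2_eq_square algebra_simps)
    then show ?thesis
      using t by simp
  qed
  have "norm b \<le> 0"
  proof (rule tendsto_lowerbound)
    show "((\<lambda>t. (5/2 * K) * t) \<longlongrightarrow> 0) (at_right 0)"
      by (auto intro!: tendsto_eq_intros)
    show "\<forall>\<^sub>F t in at_right 0. norm b \<le> (5/2 * K) * t"
      by (rule eventually_mono[OF eventually_at_right_real[of 0 "1/2"]]) (use le in auto)
  qed simp
  then show ?thesis
    by simp
qed

text \<open>On the ray through \<open>\<zeta>\<close> the transfer function is
  \<open>t D u + t\<^sup>2 C x\<close>, where the state \<open>x\<close> differs from
  \<open>b\<close> by O(t). Comparison with \<open>t\<^sup>2 q\<close> therefore leaves an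
  expression affine in \<open>t\<close> of size O(t^2).\<close>

lemma transfer_function_quadratic_part:
  fixes \<alpha> :: "('n::finite, 'x::complex_hilbert, 'u::complex_hilbert, 'y::complex_hilbert)
      scattering_system"
  assumes \<alpha>: "dissipative \<alpha>" and \<zeta>: "\<zeta> \<in> torus"
    and eq: "\<And>t. 0 < t \<Longrightarrow> t \<le> 1/2 \<Longrightarrow>
      transfer_function \<alpha> (complex_of_real t *s \<zeta>) u = t\<^sup>2 *\<^sub>R q"
  shows "tuple_comb \<zeta> (opC \<alpha>) (tuple_comb \<zeta> (opB \<alpha>) u) = q"
proof -
  define A where "A = tuple_comb \<zeta> (opA \<alpha>)"
  define C where "C = tuple_comb \<zeta> (opC \<alpha>)"
  define D where "D = tuple_comb \<zeta> (opD \<alpha>)"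
  define b where "b = tuple_comb \<zeta> (opB \<alpha>) u"
  have A: "norm A \<le> 1" and C: "norm C \<le> 1"
    using dissipative_contractive[OF \<alpha> \<zeta>] by (auto simp: A_def C_def)
  have "norm (D u + t *\<^sub>R (C b - q)) \<le> (2 * norm b) * t\<^sup>2" if t: "0 < t" "t \<le> 1/2" for t
  proof -
    define x where "x = blinfun_inverse (id_blinfun - t *\<^sub>R A) b"
    have tA: "norm (t *\<^sub>R A) \<le> 1/2"
      using mult_mono[of t "1/2" "norm A" 1] A t by simp
    then have "(id_blinfun - t *\<^sub>R A) x = b"
      using blinfun_neumann_inverse[of "t *\<^sub>R A"]
      unfolding x_def by (auto dest!: arg_cong[where f = "\<lambda>S. blinfun_apply S b"])
    then have x: "x = b + t *\<^sub>R A x"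
      by (simp add: blinfun.diff_left blinfun.scaleR_left algebra_simps)
    have Ax: "norm (A x) \<le> norm x"
      using norm_blinfun[of A x] A mult_left_le_one_le[of "norm x" "norm A"] by simp
    have "norm x \<le> norm b + norm (t *\<^sub>R A x)"
      by (subst x) (rule norm_triangle_ineq)
    also have "norm (t *\<^sub>R A x) \<le> 1/2 * norm x"
      using mult_mono[of t "1/2" "norm (A x)" "norm x"] t Ax by simp
    finally have xb: "norm x \<le> 2 * norm b"
      by simp
    have "t *\<^sub>R D u + t\<^sup>2 *\<^sub>R C x = t\<^sup>2 *\<^sub>R q"
      using eq[OF t] unfolding transfer_function_def tuple_comb_scale
      by (simp add: blinfun.add_left blinfun.scaleR_left blinfun.scaleR_right power2_eq_square
          flip: A_def C_def D_def b_def x_def)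
    then have "t *\<^sub>R (D u + t *\<^sub>R C x) = t *\<^sub>R (t *\<^sub>R q)"
      by (simp add: power2_eq_square scaleR_add_right)
    then have "D u + t *\<^sub>R C x = t *\<^sub>R q"
      using t by (simp del: scaleR_scaleR)
    \<comment> \<open>One more use of the resolvent identity isolates the error; it is controlled
      because \<open>x\<close> stays bounded by \<open>2 * norm b\<close>.\<close>
    moreover have "C x = C b + t *\<^sub>R C (A x)"
      by (subst x) (simp add: blinfun.add_right blinfun.scaleR_right)
    ultimately have "D u + t *\<^sub>R (C b - q) = - (t\<^sup>2 *\<^sub>R C (A x))"
      by (simp add: power2_eq_square algebra_simps)
    then have "norm (D u + t *\<^sub>R (C b - q)) = t\<^sup>2 * norm (C (A x))"
      by simp
    also have "norm (C (A x)) \<le> norm (A x)"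
      using norm_blinfun[of C "A x"] C mult_left_le_one_le[of "norm (A x)" "norm C"] by simp
    then have "t\<^sup>2 * norm (C (A x)) \<le> t\<^sup>2 * (2 * norm b)"
      using Ax xb by (intro mult_left_mono) auto
    finally show ?thesis
      by (simp add: mult.commute)
  qed
  then have "C b - q = 0"
    by (rule linear_term_zero_if_quadratic_bound)
  then show ?thesis
    by (simp add: C_def b_def)
qed

section \<open>The obstruction at the cube roots of unity\<close>

lemma p_poly_not_transfer_function:
  fixes \<alpha> :: "(3, 'x::complex_hilbert, complex, complex) scattering_system"
  assumes \<alpha>: "dissipative \<alpha>"
    and eq: "\<And>z. z \<in> polydisk \<Longrightarrow> transfer_function \<alpha> z = scalar_op (p_poly z)"
  shows False
proof -
  define b where "b = (\<lambda>z :: complex ^ 3. tuple_comb z (opB \<alpha>) 1)"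
  define C where "C = (\<lambda>z :: complex ^ 3. tuple_comb z (opC \<alpha>))"
  \<comment> \<open>Matrix of the bilinear form \<open>C y (b z)\<close>. The values of p see it
    only on the diagonal \<open>y = z\<close>, hence only through its symmetrization.\<close>
  define m where "m = (\<lambda>j k. opC \<alpha> j (opB \<alpha> k 1))"
  have lin: "opC \<alpha> j (c *\<^sub>C x) = c * opC \<alpha> j x" for j c x
    using \<alpha> by (simp add: dissipative_def bounded_clinear_ops_def scaleC_complex_def)
  have Cb: "C y (b z) = (\<Sum>j\<in>UNIV. \<Sum>k\<in>UNIV. y $ j * (z $ k) * m j k)" for y z
    by (subst sum.swap) (simp add: C_def b_def tuple_comb_apply blinfun.sum_right lin m_def
        sum_distrib_left mult_ac scaleC_complex_def)
  have quad: "C z (b z) = p_poly z" if z: "z \<in> torus" for z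
    unfolding C_def b_def
  proof (rule transfer_function_quadratic_part[OF \<alpha> z])
    fix t :: real assume t: "0 < t" "t \<le> 1/2"
    have "complex_of_real t *s z \<in> polydisk"
      using t z by (auto simp: polydisk_def torus_def norm_mult)
    then show "transfer_function \<alpha> (complex_of_real t *s z) 1 = t\<^sup>2 *\<^sub>R p_poly z"
      by (simp add: eq p_poly_def scaleR_conv_of_real power2_eq_square algebra_simps)
  qed
  \<comment> \<open>The two factors are contractions separately, so the bound also holds off the
    diagonal; this is stronger than the bound on p.\<close>
  have bound: "cmod (C y (b z)) \<le> 1" if "y \<in> torus" "z \<in> torus" for y z
  proof -
    have "cmod (C y (b z)) \<le> norm (C y) * norm (b z)"
      by (rule norm_blinfun)
    also have "\<dots> \<le> 1 * 1"
      using dissipative_contractive[OF \<alpha> that(1)] dissipative_contractive[OF \<alpha> that(2)]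
        norm_blinfun[of "tuple_comb z (opB \<alpha>)" 1]
      by (intro mult_mono) (auto simp: C_def b_def)
    finally show ?thesis
      by simp
  qed
  have torusI: "vector [x, y, w] \<in> (torus :: (complex ^ 3) set)"
    if "cmod x = 1" "cmod y = 1" "cmod w = 1" for x y w
    using that by (auto simp: torus_def forall_3)
  note ev = quad[OF torusI, unfolded Cb p_poly_def UNIV_3, simplified vector_3, simplified]
  define s where "s = m 1 1 + m 2 2 + m 3 3"
  define r where "r j k = m j k + m k j" for j k
  \<comment> \<open>At sign vectors all squares are 1, so the diagonal enters only through its sum
    \<open>s\<close>. Adding the four equations isolates \<open>s\<close>.\<close>
  have "5 * (s + r 1 2 + r 1 3 + r 2 3) = - 3" "5 * (s + r 1 2 - r 1 3 - r 2 3) = 5"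
    "5 * (s - r 1 2 + r 1 3 - r 2 3) = 5" "5 * (s - r 1 2 - r 1 3 + r 2 3) = 5"
    using ev[of 1 1 1] ev[of 1 1 "-1"] ev[of 1 "-1" 1] ev[of "-1" 1 1]
    by (simp_all add: s_def r_def algebra_simps)
  then have "5 * s = 3" "5 * (r 1 2 + r 1 3 + r 2 3) = - 6"
    by algebra+
  then have s: "s = 3/5" and r: "r 1 2 + r 1 3 + r 2 3 = - 6/5"
    by (auto simp: field_simps)
  define \<omega> where "\<omega> = Complex (-1/2) (sqrt 3 / 2)"
  have w: "\<omega> * \<omega> = cnj \<omega>" "cnj \<omega> * cnj \<omega> = \<omega>" "\<omega> * cnj \<omega> = 1" "\<omega> + cnj \<omega> = -1"
    by (auto simp: \<omega>_def complex_eq_iff)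
  have nw: "cmod \<omega> = 1"
    by (simp add: \<omega>_def cmod_def power_divide)
  define z :: "complex ^ 3" where "z = vector [1, \<omega>, cnj \<omega>]"
  define z' :: "complex ^ 3" where "z' = vector [1, cnj \<omega>, \<omega>]"
  have zt: "z \<in> torus" "z' \<in> torus"
    unfolding z_def z'_def by (auto intro!: torusI simp: nw)
  \<comment> \<open>Symmetrizing in \<open>z\<close> and its conjugate \<open>z'\<close> leaves only
    \<open>s\<close> and \<open>r\<close>. The last summand vanishes as \<open>\<omega>\<close> is
    unimodular; it makes the line a polynomial identity.\<close>
  have "C z' (b z) + C z (b z') = 2 * s + (\<omega> + cnj \<omega>) * (r 1 2 + r 1 3)
      + (\<omega> * \<omega> + cnj \<omega> * cnj \<omega>) * r 2 3 + 2 * (\<omega> * cnj \<omega> - 1) * (m 2 2 + m 3 3)"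
    unfolding Cb UNIV_3 by (simp add: z_def z'_def vector_3 s_def r_def algebra_simps)
  also have "\<dots> = 2 * s - (r 1 2 + r 1 3 + r 2 3)"
    using w by (simp add: add.commute)
  \<comment> \<open>This exceeds 2, the most that two terms of modulus at most 1 can reach.\<close>
  also have "\<dots> = 12/5"
    by (simp add: s r)
  finally have "cmod (C z' (b z) + C z (b z')) = cmod (12/5)"
    by (rule arg_cong)
  then show False
    using norm_triangle_ineq[of "C z' (b z)" "C z (b z')"]
      bound[OF zt(2) zt(1)] bound[OF zt] by simp
qed

theorem mainTheorem1:
  shows "p_poly 0 = 0 \<and> (\<forall>z\<in>polydisk. cmod (p_poly z) \<le> 1) \<and>
    \<not> (\<exists>\<alpha> :: (3, 'x::complex_hilbert, complex, complex) scattering_system.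
        dissipative \<alpha> \<and> (\<forall>z\<in>polydisk. transfer_function \<alpha> z = scalar_op (p_poly z))) \<and>
    contractive_operator_function (\<lambda>z. scalar_op (p_poly z)) \<and>
    \<not> (\<forall>\<theta> :: complex ^ 3 \<Rightarrow> (complex \<Rightarrow>\<^sub>L complex).
        contractive_operator_function \<theta> \<and> \<theta> 0 = 0 \<longrightarrow>
        (\<exists>\<alpha> :: (3, 'x, complex, complex) scattering_system.
          dissipative \<alpha> \<and> (\<forall>z\<in>polydisk. transfer_function \<alpha> z = \<theta> z)))"
proof -
  have p0: "p_poly 0 = 0"
    by (simp add: p_poly_def)
  \<comment> \<open>p itself refutes the universal claim in the last conjunct, which requires
    vanishing at the origin.\<close>
  then have "scalar_op (p_poly 0) = 0"
    by (intro blinfun_eqI) simp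
  then show ?thesis
    using p0 cmod_p_poly_le contractive_p_poly p_poly_not_transfer_function by blast
qed

end
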